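(* Let $f:\mathbb{R}^n\to\mathbb{R}$ be a smooth convex function with nonempty minimizer set $S$, let $x_0\in\mathbb{R}^n$, and let $(x_j)_{j\ge0}$ be generated by the asynchronous stochastic coordinate descent iteration (defined in the context, unconstrained case) with delay bound $\tau$ and steplength parameter $\gamma$. Suppose that $$\tau + 1 \le \frac{\sqrt{n}\, L_{\max}}{2eL_{\mathrm{res}}}.$$ Then if we choose $$\rho=1+\frac{2eL_{\mathrm{res}}}{\sqrt{n}\,L_{\max}},$$ define $$\psi := 1+ \frac{2 \tau \rho^{\tau} L_{\mathrm{res}}}{\sqrt{n}\, L_{\max}},$$ and set $\gamma=1/\psi$, we have, in the case that the essential strong convexity property (defined in the context) holds with parameter $l>0$, that $$\mathbb{E} (f(x_j)-f^* ) \le \left( 1-\frac{l}{2nL_{\max}} \right)^j (f(x_0)-f^* ).$$ For the case of general smooth convex $f$, if we assume additionally that there is a real number $R$ such that $\|x_j-\mathcal{P}_S(x_j)\|\le R$ for all $j=0,1,2,\dots$, we have $$\mathbb{E} (f(x_j)-f^* ) \le \frac{1}{(f(x_0)-f^* )^{-1} + j/(4n L_{\max} R^2)}.$$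
   Context: Notation: $\|\cdot\|$ is the Euclidean norm, $e_i$ the $i$th standard basis vector, $\nabla_i f(x)$ the $i$th component of $\nabla f(x)$; in the constants, $e$ is the base of the natural logarithm. $S$ is the set of minimizers of $f$ over $\mathbb{R}^n$ (assumed nonempty), $f^*$ the optimal value, and $\mathcal{P}_S$ is Euclidean projection onto $S$. Lipschitz constants: $L_{\mathrm{res}}$ is the restricted Lipschitz constant of $\nabla f$: $\|\nabla f(x)-\nabla f(x+te_i)\|\le L_{\mathrm{res}}|t|$ for all $i=1,\dots,n$, $x\in\mathbb{R}^n$, $t\in\mathbb{R}$. $L_i$ is the coordinate Lipschitz constant of $\nabla f$ in the $i$th coordinate direction: $f(x+te_i)-f(x)\le \nabla_i f(x)\,t+\frac{L_i}{2}t^2$ for all $x,t$, or equivalently $|\nabla_i f(x)-\nabla_i f(x+te_i)|\le L_i|t|$. $L_{\max}:=\max_{i=1,\dots,n} L_i$. One has $L_{\mathrm{res}}\ge L_{\max}$. Essential strong convexity with parameter $l>0$: $f(x)-f(y)\ge\langle\nabla f(y),x-y\rangle+\frac{l}{2}\|x-y\|^2$ for all $x,y\in\mathbb{R}^n$ with $\mathcal{P}_S(x)=\mathcal{P}_S(y)$. Iteration (unconstrained case): several processors update a shared vector $x$ without synchronization; $x_j$ is the state of $x$ after $j$ updates. At each step $j=0,1,2,\dots$ an index $i(j)$ is chosen at random from $\{1,\dots,n\}$ with equal probability, and $$x_{j+1}=x_j-\frac{\gamma}{L_{\max}}\,e_{i(j)}\nabla_{i(j)}f(x_{k(j)}),$$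 where $k(j)$ is the index of the iterate at which the update applied at step $j$ was calculated. It satisfies $k(j)\le j$, and the delay is assumed to be bounded uniformly by a positive integer $\tau$: $j-k(j)\le\tau$ for all $j$. The indices $i(j)$ are random variables, and $\mathbb{E}$ denotes expectation over all random variables. *)

theory Defs
  imports "HOL-Probability.Probability"
begin

definition minimizers :: "('v \<Rightarrow> real) \<Rightarrow> 'v set" where
  "minimizers f = {x. \<forall>y. f x \<le> f y}"

definition opt_value :: "('v \<Rightarrow> real) \<Rightarrow> real" where
  "opt_value f = (INF x. f x)"

text \<open>
  The gradient is passed as a function \<open>g\<close>, which the theorem ties to \<open>f\<close> by \<open>GDERIV f x :> g x\<close>.
  The constants below are arbitrary admissible ones, not necessarily the smallest.
\<close>

definition restricted_lipschitz :: "(real ^ 'n \<Rightarrow> real ^ 'n) \<Rightarrow> real \<Rightarrow> bool" where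
  "restricted_lipschitz g Lres \<longleftrightarrow>
     (\<forall>i x t. norm (g x - g (x + t *\<^sub>R axis i 1)) \<le> Lres * \<bar>t\<bar>)"

definition coord_lipschitz ::
    "(real ^ 'n \<Rightarrow> real) \<Rightarrow> (real ^ 'n \<Rightarrow> real ^ 'n) \<Rightarrow> ('n \<Rightarrow> real) \<Rightarrow> bool" where
  "coord_lipschitz f g L \<longleftrightarrow>
     (\<forall>i x t. f (x + t *\<^sub>R axis i 1) - f x \<le> g x $ i * t + L i / 2 * t\<^sup>2)"

text \<open>
  For convex continuous \<open>f\<close> with a minimizer, \<open>minimizers f\<close> is nonempty, closed and convex, so
  \<^const>\<open>closest_point\<close> is the Euclidean projection onto it.
\<close>

definition essentially_strongly_convex ::
    "(real ^ 'n \<Rightarrow> real) \<Rightarrow> (real ^ 'n \<Rightarrow> real ^ 'n) \<Rightarrow> real \<Rightarrow> bool" where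
  "essentially_strongly_convex f g l \<longleftrightarrow>
     (\<forall>x y. closest_point (minimizers f) x = closest_point (minimizers f) y \<longrightarrow>
        f x - f y \<ge> g y \<bullet> (x - y) + l / 2 * (norm (x - y))\<^sup>2)"

definition iid_uniform_indices :: "'w measure \<Rightarrow> (nat \<Rightarrow> 'w \<Rightarrow> 'n::finite) \<Rightarrow> bool" where
  "iid_uniform_indices M i \<longleftrightarrow>
     prob_space.indep_vars M (\<lambda>_. count_space UNIV) i UNIV \<and>
     (\<forall>j. distr M (count_space UNIV) (i j) = uniform_count_measure UNIV)"

text \<open>
  The schedule \<open>k\<close> is arbitrary but not random: the only random variables are the indices \<open>i j\<close>.
\<close>

definition bounded_delay :: "nat \<Rightarrow> (nat \<Rightarrow> nat) \<Rightarrow> bool" where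
  "bounded_delay \<tau> k \<longleftrightarrow> (\<forall>j. k j \<le> j \<and> j - k j \<le> \<tau>)"

text \<open>The argument \<open>s\<close> is the steplength, \<open>\<gamma> / L\<^sub>m\<^sub>a\<^sub>x\<close> in the theorem.\<close>

definition async_scd ::
    "'w measure \<Rightarrow> (nat \<Rightarrow> 'w \<Rightarrow> 'n) \<Rightarrow> (nat \<Rightarrow> nat) \<Rightarrow> (real ^ 'n \<Rightarrow> real ^ 'n) \<Rightarrow> real
      \<Rightarrow> real ^ 'n \<Rightarrow> (nat \<Rightarrow> 'w \<Rightarrow> real ^ 'n) \<Rightarrow> bool" where
  "async_scd M i k g s x0 x \<longleftrightarrow>
     (\<forall>\<omega>\<in>space M. x 0 \<omega> = x0 \<and>
        (\<forall>j. x (Suc j) \<omega> = x j \<omega> - (s * g (x (k j) \<omega>) $ i j \<omega>) *\<^sub>R axis (i j \<omega>) 1))"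

end

theory Submission
  imports Defs
begin

text \<open>
  Write \<open>a j\<close> for the expectation of \<open>\<parallel>g (x j)\<parallel>\<^sup>2\<close> and \<open>q = Lres / (sqrt n * Lmax)\<close>.
  A single update changes the gradient by at most \<open>Lres * \<gamma> / Lmax\<close> times one component of a
  stale gradient, and the index of that component is independent of everything that happened
  before, so that \<open>\<bar>a (j + 1) - a j\<bar>\<close> is bounded by a multiple of \<open>a j + a (k j)\<close>.  By induction
  \<open>a\<close> grows or shrinks by at most a factor \<open>\<rho>\<close> per step, hence by at most \<open>\<rho> ^ \<tau>\<close> over a delay.

  The same bound, summed over the steps from \<open>k j\<close> to \<open>j\<close>, controls the error made by using the
  stale gradient at \<open>x (k j)\<close> in the coordinate descent inequality, and yields
  \<open>E (f (x (j + 1))) \<le> E (f (x j)) - \<gamma> * (1 - \<gamma> * \<psi> / 2) / (n * Lmax) * a (k j)\<close>.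
  In particular \<open>E (f (x j))\<close> is decreasing, so a lower bound of \<open>a (k j)\<close> by the optimality gap
  at \<open>k j\<close> is also one by the gap at \<open>j\<close>.  Strong convexity gives such a bound that is linear in
  the gap, plain convexity with bounded distance to the minimizers one that is quadratic.
  The condition on \<open>\<tau>\<close> enters through \<open>\<rho> ^ (\<tau> + 1) \<le> exp 1\<close>, whence \<open>\<psi> \<le> 2\<close>.
\<close>

section \<open>Deterministic inequalities between gradient and optimality gap\<close>

text \<open>Restricting \<open>f\<close> to the line through \<open>x\<close> and \<open>y\<close>
  gives a convex function of one real variable with derivative \<open>d \<bullet> (y - x)\<close> at
  0, so the one-dimensional tangent inequality applies.\<close>

lemma gderiv_convex_above_tangent:
  fixes f :: "'a::real_inner \<Rightarrow> real"
  assumes convex: "convex_on UNIV f" and gderiv: "GDERIV f x :> d"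
  shows "f y - f x \<ge> d \<bullet> (y - x)"
proof -
  define h where "h t = f (x + t *\<^sub>R (y - x))" for t
  have "convex_on UNIV h"
  proof (rule convex_onI)
    fix t a b :: real
    assume "0 < t" "t < 1"
    have "x + ((1 - t) *\<^sub>R a + t *\<^sub>R b) *\<^sub>R (y - x)
        = (1 - t) *\<^sub>R (x + a *\<^sub>R (y - x)) + t *\<^sub>R (x + b *\<^sub>R (y - x))"
      by (simp add: algebra_simps)
    then show "h ((1 - t) *\<^sub>R a + t *\<^sub>R b) \<le> (1 - t) * h a + t * h b"
      unfolding h_def using convex_onD[OF convex, of t] \<open>0 < t\<close> \<open>t < 1\<close> by simp
  qed simp
  moreover have "(h has_field_derivative d \<bullet> (y - x)) (at 0)"
  proof -
    have f: "(f has_derivative (\<lambda>v. v \<bullet> d)) (at (x + 0 *\<^sub>R (y - x)))"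
      using gderiv by (simp add: gderiv_def)
    have l: "((\<lambda>t. x + t *\<^sub>R (y - x)) has_derivative (\<lambda>t. t *\<^sub>R (y - x))) (at 0)"
      by (auto intro!: derivative_eq_intros)
    have "(h has_derivative (\<lambda>t. (t *\<^sub>R (y - x)) \<bullet> d)) (at 0)"
      unfolding h_def by (rule has_derivative_compose[OF l f])
    then show ?thesis
      by (simp add: has_field_derivative_def inner_commute mult.commute[of _ "_ \<bullet> _"])
  qed
  ultimately have "h 1 - h 0 \<ge> d \<bullet> (y - x) * (1 - 0)"
    by (intro convex_on_imp_above_tangent[where A = UNIV]) auto
  then show ?thesis
    by (simp add: h_def)
qed

lemma closed_minimizers:
  fixes f :: "'a::topological_space \<Rightarrow> real"
  assumes "continuous_on UNIV f"
  shows "closed (minimizers f)"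
proof -
  have "minimizers f = (\<Inter>y. {x. f x \<le> f y})"
    by (auto simp: minimizers_def)
  then show ?thesis
    by (auto intro!: closed_INT closed_Collect_le assms)
qed

lemma opt_value_eq:
  assumes "z \<in> minimizers f"
  shows "opt_value f = f z"
  using assms by (auto simp: opt_value_def minimizers_def intro!: cInf_eq_minimum)

text \<open>The step \<open>- (g y $ c) / L\<close> minimizes the quadratic upper model along axis
  \<open>c\<close>. The decrease it guarantees, \<open>(g y $ c)\<^sup>2 / (2 * L)\<close>, cannot
  exceed the gap to the minimum.\<close>

lemma coord_lipschitz_component_sq_le:
  assumes f: "coord_lipschitz f g (\<lambda>_. L)" and "0 < L" and z: "z \<in> minimizers f"
  shows "(g y $ c)\<^sup>2 \<le> 2 * L * (f y - f z)"
proof -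
  define t where "t = - (g y $ c) / L"
  have "f (y + t *\<^sub>R axis c 1) - f y \<le> g y $ c * t + L / 2 * t\<^sup>2"
    using f unfolding coord_lipschitz_def by blast
  also have "\<dots> = - ((g y $ c)\<^sup>2 / (2 * L))"
    using \<open>0 < L\<close> by (simp add: t_def power2_eq_square field_simps)
  finally have "(g y $ c)\<^sup>2 / (2 * L) \<le> f y - f (y + t *\<^sub>R axis c 1)" by simp
  also have "\<dots> \<le> f y - f z" using z by (simp add: minimizers_def)
  finally show ?thesis using \<open>0 < L\<close> by (simp add: field_simps)
qed

text \<open>Set against \<open>essentially_strongly_convex_gap_le\<close>, this upper bound caps
  \<open>l\<close> by \<open>n * Lmax\<close>, which keeps the linear rate nonnegative.\<close>

lemma coord_lipschitz_norm_sq_le: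
  fixes f :: "real ^ 'n \<Rightarrow> real"
  assumes "coord_lipschitz f g (\<lambda>_. L)" "0 < L" "z \<in> minimizers f"
  shows "(norm (g y))\<^sup>2 \<le> 2 * real CARD('n) * L * (f y - f z)"
proof -
  have "(norm (g y))\<^sup>2 = (\<Sum>c\<in>UNIV. (g y $ c)\<^sup>2)"
    unfolding power2_norm_eq_inner by (simp add: inner_vec_def power2_eq_square)
  also have "\<dots> \<le> (\<Sum>c\<in>(UNIV :: 'n set). 2 * L * (f y - f z))"
    by (intro sum_mono coord_lipschitz_component_sq_le[OF assms])
  finally show ?thesis by (simp add: mult_ac)
qed

text \<open>A Polyak-Lojasiewicz inequality. Strong convexity is applied to \<open>y\<close> and its
  projection \<open>p\<close>, an admissible pair because \<open>p\<close> is its own projection;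
  completing the square in \<open>l * norm (p - y)\<close> then removes the unknown
  distance.\<close>

lemma essentially_strongly_convex_gap_le:
  fixes f :: "real ^ 'n \<Rightarrow> real"
  assumes esc: "essentially_strongly_convex f g l" and "0 < l"
    and S: "closed (minimizers f)" "z \<in> minimizers f"
  shows "2 * l * (f y - f z) \<le> (norm (g y))\<^sup>2"
proof -
  define p where "p = closest_point (minimizers f) y"
  have p: "p \<in> minimizers f" unfolding p_def using S by (auto intro: closest_point_in_set)
  then have fp: "f p = f z" using S(2) by (simp add: minimizers_def order_antisym)
  have "closest_point (minimizers f) p = closest_point (minimizers f) y"
    using closest_point_self[OF p] by (simp add: p_def)
  then have "f p - f y \<ge> g y \<bullet> (p - y) + l / 2 * (norm (p - y))\<^sup>2"
    using esc unfolding essentially_strongly_convex_def by blast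
  moreover have "- (norm (g y) * norm (p - y)) \<le> g y \<bullet> (p - y)"
    using Cauchy_Schwarz_ineq2[of "g y" "p - y"] by linarith
  ultimately have "f y - f z \<le> norm (g y) * norm (p - y) - l / 2 * (norm (p - y))\<^sup>2"
    using fp by linarith
  then have "2 * l * (f y - f z) \<le> 2 * l * (norm (g y) * norm (p - y) - l / 2 * (norm (p - y))\<^sup>2)"
    using \<open>0 < l\<close> by simp
  also have "\<dots> = (norm (g y))\<^sup>2 - (norm (g y) - l * norm (p - y))\<^sup>2"
    by (simp add: power2_eq_square algebra_simps)
  also have "\<dots> \<le> (norm (g y))\<^sup>2" by simp
  finally show ?thesis .
qed

section \<open>Scalar inequalities and recursions\<close>

lemma mult_le_weighted_squares:
  fixes u v c :: real
  assumes "0 < c"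
  shows "2 * (u * v) \<le> u\<^sup>2 / c + c * v\<^sup>2"
proof -
  have "u\<^sup>2 / c + c * v\<^sup>2 - 2 * (u * v) = (u - c * v)\<^sup>2 / c"
    using assms by (simp add: field_simps power2_eq_square)
  then show ?thesis using assms by (metis diff_ge_0_iff_ge divide_nonneg_pos zero_le_power2)
qed

text \<open>The ratio is assumed only below \<open>b\<close>, so that the lemma can be used inside
  the strong induction of \<open>gradsq_le_Suc\<close>, where nothing is known yet at
  \<open>b\<close> itself.\<close>

lemma geometric_ratio_le:
  fixes a :: "nat \<Rightarrow> real"
  assumes a: "\<And>m. m < b \<Longrightarrow> a m \<le> \<rho> * a (Suc m)" and "1 \<le> \<rho>"
    and "m \<le> b" "b \<le> m + t" "0 \<le> a b"
  shows "a m \<le> \<rho> ^ t * a b"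
proof -
  have "d \<le> b \<Longrightarrow> a (b - d) \<le> \<rho> ^ d * a b" for d
  proof (induction d)
    case (Suc d)
    have "a (b - Suc d) \<le> \<rho> * a (Suc (b - Suc d))" using Suc.prems by (intro a) simp
    also have "Suc (b - Suc d) = b - d" using Suc.prems by simp
    also have "\<rho> * a (b - d) \<le> \<rho> * (\<rho> ^ d * a b)"
      using Suc \<open>1 \<le> \<rho>\<close> by (intro mult_left_mono) auto
    finally show ?case by (simp add: mult_ac)
  qed simp
  from this[of "b - m"] have "a m \<le> \<rho> ^ (b - m) * a b" using \<open>m \<le> b\<close> by simp
  also have "\<dots> \<le> \<rho> ^ t * a b"
    using assms by (intro mult_right_mono power_increasing) auto
  finally show ?thesis .
qed

lemma geometric_ratio_ge:
  fixes a :: "nat \<Rightarrow> real"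
  assumes a: "\<And>m. a (Suc m) \<le> \<rho> * a m" and "1 \<le> \<rho>"
    and "b \<le> m" "m \<le> b + t" "0 \<le> a b"
  shows "a m \<le> \<rho> ^ t * a b"
proof -
  have "a (b + d) \<le> \<rho> ^ d * a b" for d
  proof (induction d)
    case (Suc d)
    have "a (b + Suc d) \<le> \<rho> * a (b + d)" using a by simp
    also have "\<dots> \<le> \<rho> * (\<rho> ^ d * a b)"
      using Suc \<open>1 \<le> \<rho>\<close> by (intro mult_left_mono) auto
    finally show ?case by (simp add: mult_ac)
  qed simp
  from this[of "m - b"] have "a m \<le> \<rho> ^ (m - b) * a b" using \<open>b \<le> m\<close> by simp
  also have "\<dots> \<le> \<rho> ^ t * a b"
    using assms by (intro mult_right_mono power_increasing) auto
  finally show ?thesis .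
qed

text \<open>
  The case \<open>\<phi> 0 = 0\<close> is included thanks to \<open>inverse 0 = 0\<close>: then \<open>\<phi> j = 0\<close> for all \<open>j\<close>.
\<close>

lemma quadratic_decrease_bound:
  fixes \<phi> :: "nat \<Rightarrow> real"
  assumes "\<And>j. 0 \<le> \<phi> j" "\<And>j. \<phi> (Suc j) \<le> \<phi> j - c * (\<phi> j)\<^sup>2" "0 \<le> c"
  shows "\<phi> j \<le> 1 / (inverse (\<phi> 0) + real j * c)"
proof -
  have "\<phi> j = 0 \<or> (0 < \<phi> 0 \<and> inverse (\<phi> 0) + real j * c \<le> inverse (\<phi> j))"
  proof (induction j)
    case 0
    then show ?case using assms(1)[of 0] by auto
  next
    case (Suc j)
    have mono: "\<phi> (Suc j) \<le> \<phi> j" using assms(2)[of j] assms(3) by (smt (verit) mult_nonneg_nonneg zero_le_power2)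
    show ?case
    proof (cases "\<phi> (Suc j) = 0")
      case False
      then have pos: "0 < \<phi> (Suc j)" "0 < \<phi> j" using assms(1)[of "Suc j"] mono by auto
      \<comment> \<open>Weakening the square to a product of consecutive terms lets one divide by
        that product: the decrease becomes growth of the reciprocal by at least \<open>c\<close> per
        step.\<close>
      have "c * \<phi> (Suc j) * \<phi> j \<le> c * (\<phi> j)\<^sup>2"
        unfolding power2_eq_square mult.assoc using pos mono assms(3) by (intro mult_left_mono mult_right_mono) auto
      then have "\<phi> (Suc j) * (1 + c * \<phi> j) \<le> \<phi> j" using assms(2)[of j] by (simp add: algebra_simps)
      then have "inverse (\<phi> j) + c \<le> inverse (\<phi> (Suc j))" using pos by (simp add: field_simps)
      moreover have "0 < \<phi> 0 \<and> inverse (\<phi> 0) + real j * c \<le> inverse (\<phi> j)" using Suc pos by auto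
      ultimately show ?thesis by (auto simp: algebra_simps)
    qed simp
  qed
  then show ?thesis
  proof
    assume "\<phi> j = 0"
    then show ?thesis using assms by (simp add: add_nonneg_nonneg)
  next
    assume *: "0 < \<phi> 0 \<and> inverse (\<phi> 0) + real j * c \<le> inverse (\<phi> j)"
    then have "0 < inverse (\<phi> 0) + real j * c" using assms(3) by (simp add: add_pos_nonneg)
    then show ?thesis using * le_imp_inverse_le by (fastforce simp: inverse_eq_divide)
  qed
qed

section \<open>Expectations of functions of finitely many uniform indices\<close>

locale uniform_index_process = prob_space M
  for M :: "'w measure" +
  fixes i :: "nat \<Rightarrow> 'w \<Rightarrow> 'n::finite"
  assumes indices: "iid_uniform_indices M i"
begin

definition history :: "nat \<Rightarrow> 'w \<Rightarrow> 'n list" where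
  "history j \<omega> = map (\<lambda>t. i t \<omega>) [0..<j]"

text \<open>Factorization through the history stands in for a filtration. A history has finitely
  many values, so a real \<open>Y\<close> of this form is integrable for every \<open>F\<close>, and
  no measurability of the gradient has to be shown.\<close>

definition adapted :: "nat \<Rightarrow> ('w \<Rightarrow> 'b) \<Rightarrow> bool" where
  "adapted j Y \<longleftrightarrow> (\<exists>F. \<forall>\<omega>\<in>space M. Y \<omega> = F (history j \<omega>))"

definition words :: "nat \<Rightarrow> 'n list set" where
  "words j = {w. length w = j}"

lemma finite_words: "finite (words j)"
  using finite_lists_length_eq[of "UNIV :: 'n set" j] by (simp add: words_def)

lemma history_in_words: "history j \<omega> \<in> words j"
  by (simp add: history_def words_def)

lemma words_Suc: "words (Suc j) = (\<lambda>(w, c). w @ [c]) ` (words j \<times> UNIV)"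
proof (intro set_eqI iffI)
  fix v
  assume "v \<in> words (Suc j)"
  then have "length v = Suc j" by (simp add: words_def)
  then have "v = butlast v @ [last v]" "length (butlast v) = j"
    by (metis append_butlast_last_id length_0_conv nat.simps(3)) (simp add: \<open>length v = Suc j\<close>)
  then show "v \<in> (\<lambda>(w, c). w @ [c]) ` (words j \<times> UNIV)"
    by (intro image_eqI[of _ _ "(butlast v, last v)"]) (auto simp: words_def)
qed (auto simp: words_def)

lemma index_measurable [measurable]: "i j \<in> measurable M (count_space UNIV)"
  using indices by (simp add: iid_uniform_indices_def indep_vars_def)

lemma prob_index: "prob (i j -` {c} \<inter> space M) = 1 / real CARD('n)"
proof -
  have "prob (i j -` {c} \<inter> space M) = measure (distr M (count_space UNIV) (i j)) {c}"
    by (simp add: measure_distr)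
  also have "\<dots> = 1 / real CARD('n)"
    using indices by (simp add: iid_uniform_indices_def measure_uniform_count_measure)
  finally show ?thesis .
qed

text \<open>The outer \<open>space M\<close> matters for \<open>j = 0\<close>, where the
  intersection over the empty index set is the whole type.\<close>

lemma history_eq_set:
  assumes "w \<in> words j"
  shows "{\<omega> \<in> space M. history j \<omega> = w} = space M \<inter> (\<Inter>t\<in>{..<j}. i t -` {w ! t} \<inter> space M)"
  using assms by (auto simp: history_def words_def list_eq_iff_nth_eq)

lemma history_sets:
  assumes "w \<in> words j"
  shows "{\<omega> \<in> space M. history j \<omega> = w} \<in> sets M"
proof (cases "j = 0")
  case False
  then show ?thesis unfolding history_eq_set[OF assms]
    by (intro sets.Int sets.top sets.finite_INT measurable_sets[OF index_measurable]) auto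
qed (use assms in \<open>simp add: history_def words_def\<close>)

lemma prob_history:
  assumes "w \<in> words j"
  shows "prob {\<omega> \<in> space M. history j \<omega> = w} = (1 / real CARD('n)) ^ j"
proof (cases "j = 0")
  case True
  then show ?thesis using assms by (simp add: history_def words_def prob_space)
next
  case False
  then have "prob {\<omega> \<in> space M. history j \<omega> = w} = prob (\<Inter>t\<in>{..<j}. i t -` {w ! t} \<inter> space M)"
    unfolding history_eq_set[OF assms] by (intro arg_cong[of _ _ prob]) auto
  also have "\<dots> = (\<Prod>t<j. prob (i t -` {w ! t} \<inter> space M))"
    using False indices unfolding iid_uniform_indices_def
    by (intro indep_varsD[of "\<lambda>_. count_space UNIV" i UNIV]) auto
  finally show ?thesis by (simp add: prob_index)
qed

text \<open>\<open>G (history j \<omega>)\<close> is a finite combination of indicators of the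
  events that the history equals a given word, all of the same probability by
  \<open>prob_history\<close>.\<close>

lemma has_integral_history:
  fixes G :: "'n list \<Rightarrow> real"
  shows "has_bochner_integral M (\<lambda>\<omega>. G (history j \<omega>))
    ((\<Sum>w\<in>words j. G w) * (1 / real CARD('n)) ^ j)"
proof -
  have "has_bochner_integral M
      (\<lambda>\<omega>. \<Sum>w\<in>words j. G w * indicator {\<omega> \<in> space M. history j \<omega> = w} \<omega>)
      (\<Sum>w\<in>words j. G w * prob {\<omega> \<in> space M. history j \<omega> = w})"
    by (intro has_bochner_integral_sum has_bochner_integral_mult_right
        has_bochner_integral_real_indicator history_sets) (auto simp: less_top[symmetric])
  moreover have "(\<Sum>w\<in>words j. G w * indicator {\<omega> \<in> space M. history j \<omega> = w} \<omega>) = G (history j \<omega>)"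
    if "\<omega> \<in> space M" for \<omega>
    using that history_in_words[of j \<omega>] finite_words[of j]
    by (simp add: indicator_def if_distrib[of "(*) _"] eq_commute sum.delta cong: if_cong)
  ultimately show ?thesis
    by (simp add: prob_history sum_distrib_right cong: has_bochner_integral_cong)
qed

lemma adapted_has_integral:
  assumes "\<And>\<omega>. \<omega> \<in> space M \<Longrightarrow> Y \<omega> = (G (history j \<omega>) :: real)"
  shows "has_bochner_integral M Y ((\<Sum>w\<in>words j. G w) * (1 / real CARD('n)) ^ j)"
  using has_integral_history[of G j] assms by (simp cong: has_bochner_integral_cong)

lemma adapted_cong:
  assumes "\<And>\<omega>. \<omega> \<in> space M \<Longrightarrow> Y \<omega> = Z \<omega>" "adapted j Z"
  shows "adapted j Y"
  using assms by (simp add: adapted_def)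

lemma adapted_mono:
  assumes "adapted m Y" "m \<le> j"
  shows "adapted j Y"
proof -
  obtain F where "\<forall>\<omega>\<in>space M. Y \<omega> = F (history m \<omega>)" using assms by (auto simp: adapted_def)
  moreover have "history m \<omega> = take m (history j \<omega>)" for \<omega>
    using assms(2) by (simp add: history_def take_map)
  ultimately show ?thesis
    unfolding adapted_def by (intro exI[of _ "\<lambda>w. F (take m w)"]) auto
qed

lemma adapted_const: "adapted j (\<lambda>_. c)"
  unfolding adapted_def by (intro exI[of _ "\<lambda>_. c"]) simp

lemma adapted_compose2:
  assumes "adapted j Y" "adapted j Z"
  shows "adapted j (\<lambda>\<omega>. h (Y \<omega>) (Z \<omega>))"
proof -
  obtain F G where "\<forall>\<omega>\<in>space M. Y \<omega> = F (history j \<omega>)" "\<forall>\<omega>\<in>space M. Z \<omega> = G (history j \<omega>)"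
    using assms by (auto simp: adapted_def)
  then show ?thesis
    unfolding adapted_def by (intro exI[of _ "\<lambda>w. h (F w) (G w)"]) auto
qed

lemma adapted_index: "adapted (Suc j) (i j)"
  unfolding adapted_def by (intro exI[of _ last]) (simp add: history_def)

lemma adapted_integrable:
  fixes Y :: "'w \<Rightarrow> real"
  assumes "adapted j Y"
  shows "integrable M Y"
  using assms adapted_has_integral has_bochner_integral_iff unfolding adapted_def by metis

text \<open>This does the work of conditioning on the first \<open>j\<close> indices. Both sides are
  sums over words, and a word of length \<open>j + 1\<close> splits uniquely into a history of
  length \<open>j\<close> and a last letter, the value of \<open>i j\<close>.\<close>

lemma expectation_fresh_index:
  assumes "adapted j Y"
  shows "expectation (\<lambda>\<omega>. H (Y \<omega>) (i j \<omega>))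
    = expectation (\<lambda>\<omega>. \<Sum>c\<in>UNIV. H (Y \<omega>) c) / real CARD('n)"
proof -
  obtain F where F: "\<And>\<omega>. \<omega> \<in> space M \<Longrightarrow> Y \<omega> = F (history j \<omega>)"
    using assms by (auto simp: adapted_def)
  have "expectation (\<lambda>\<omega>. H (Y \<omega>) (i j \<omega>))
      = (\<Sum>w\<in>words (Suc j). H (F (butlast w)) (last w)) * (1 / real CARD('n)) ^ Suc j"
    by (intro has_bochner_integral_integral_eq adapted_has_integral) (simp add: F history_def)
  also have "(\<Sum>w\<in>words (Suc j). H (F (butlast w)) (last w))
      = (\<Sum>(w, c)\<in>words j \<times> UNIV. H (F w) c)"
    unfolding words_Suc by (subst sum.reindex) (auto simp: inj_on_def intro!: sum.cong)
  also have "\<dots> = (\<Sum>w\<in>words j. \<Sum>c\<in>UNIV. H (F w) c)"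
    by (simp add: sum.cartesian_product)
  also have "\<dots> * (1 / real CARD('n)) ^ Suc j
      = (\<Sum>w\<in>words j. \<Sum>c\<in>UNIV. H (F w) c) * (1 / real CARD('n)) ^ j / real CARD('n)"
    by simp
  also have "(\<Sum>w\<in>words j. \<Sum>c\<in>UNIV. H (F w) c) * (1 / real CARD('n)) ^ j
      = expectation (\<lambda>\<omega>. \<Sum>c\<in>UNIV. H (Y \<omega>) c)"
    by (intro has_bochner_integral_integral_eq[symmetric] adapted_has_integral) (simp add: F)
  finally show ?thesis .
qed

end

section \<open>Asynchronous iterates as functions of the indices\<close>

text \<open>\<open>gamma_le1\<close> serves the backward ratio bound \<open>gradsq_le_Suc\<close>,
  \<open>gamma_le2\<close> the forward bound \<open>gradsq_Suc_le\<close>;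
  \<open>steplength_constants\<close> later derives both from the bound on the delay.\<close>

locale async_descent = uniform_index_process M i
  for M :: "'w measure" and i :: "nat \<Rightarrow> 'w \<Rightarrow> 'n::finite" +
  fixes f :: "real ^ 'n \<Rightarrow> real" and g :: "real ^ 'n \<Rightarrow> real ^ 'n"
    and Lmax Lres \<gamma> \<rho> q :: real and \<tau> :: nat and k :: "nat \<Rightarrow> nat"
    and x0 :: "real ^ 'n" and x :: "nat \<Rightarrow> 'w \<Rightarrow> real ^ 'n"
  defines "q \<equiv> Lres / (sqrt (real CARD('n)) * Lmax)"
  assumes lipschitz: "restricted_lipschitz g Lres"
    and coord: "coord_lipschitz f g (\<lambda>_. Lmax)"
    and Lmax_pos: "0 < Lmax"
    and Lres_nonneg: "0 \<le> Lres"
    and gamma_pos: "0 < \<gamma>"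
    and rho_ge_1: "1 \<le> \<rho>"
    and gamma_le1: "2 * \<gamma> * q * \<rho> ^ (\<tau> + 1) \<le> \<rho> - 1"
    and gamma_le2: "\<gamma> * q * \<rho> ^ \<tau> * (2 + \<gamma> * q) \<le> \<rho> - 1"
    and delay: "bounded_delay \<tau> k"
    and iteration: "async_scd M i k g (\<gamma> / Lmax) x0 x"
begin

lemma q_nonneg: "0 \<le> q"
  using Lmax_pos Lres_nonneg by (simp add: q_def)

lemma k_le: "k j \<le> j" and le_k: "j \<le> k j + \<tau>"
  using delay unfolding bounded_delay_def by (simp_all add: le_diff_conv add.commute)

lemma x_0: "\<omega> \<in> space M \<Longrightarrow> x 0 \<omega> = x0"
  using iteration by (simp add: async_scd_def)

lemma x_Suc:
  "\<omega> \<in> space M \<Longrightarrow>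
    x (Suc j) \<omega> = x j \<omega> + (- (\<gamma> / Lmax * g (x (k j) \<omega>) $ i j \<omega>)) *\<^sub>R axis (i j \<omega>) 1"
  using iteration by (simp add: async_scd_def)

text \<open>Strong induction, since the update producing \<open>x (Suc m)\<close> also reads the
  older iterate \<open>x (k m)\<close>.\<close>

lemma adapted_x: "adapted j (x j)"
proof (induction j rule: less_induct)
  case (less j)
  show ?case
  proof (cases j)
    case 0
    then show ?thesis using adapted_cong[OF x_0 adapted_const] by simp
  next
    case (Suc m)
    have "adapted (Suc m) (x m)" "adapted (Suc m) (x (k m))"
      using less.IH[of m] less.IH[of "k m"] k_le[of m] Suc by (auto intro: adapted_mono)
    then have "adapted (Suc m) (\<lambda>\<omega>. (x m \<omega>, x (k m) \<omega>))"
      by (rule adapted_compose2)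
    from adapted_compose2[OF this adapted_index,
        of "\<lambda>(u, v) c. u + (- (\<gamma> / Lmax * g v $ c)) *\<^sub>R axis c 1"]
    show ?thesis
      unfolding Suc by (rule adapted_cong[rotated]) (simp add: x_Suc)
  qed
qed

lemma adapted_pair:
  assumes "m \<le> j" "m' \<le> j"
  shows "adapted j (\<lambda>\<omega>. (x m \<omega>, x m' \<omega>))"
  by (intro adapted_compose2[where h = Pair] adapted_mono[OF adapted_x] assms)

text \<open>Two iterates and one index are all determined by a long enough history, so every
  function \<open>H\<close> of them is integrable. This settles the integrability side conditions
  below.\<close>

lemma integrable_trajectory:
  fixes H :: "real ^ 'n \<Rightarrow> real ^ 'n \<Rightarrow> 'n \<Rightarrow> real"
  shows "integrable M (\<lambda>\<omega>. H (x m \<omega>) (x m' \<omega>) (i j \<omega>))"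
proof -
  define b where "b = max (Suc j) (max m m')"
  have "adapted b (\<lambda>\<omega>. (x m \<omega>, x m' \<omega>))" "adapted b (i j)"
    by (auto simp: b_def intro!: adapted_pair adapted_mono[OF adapted_index])
  from adapted_integrable[OF adapted_compose2[OF this, of "\<lambda>(u, v) c. H u v c"]]
  show ?thesis by simp
qed

lemma integrable_iterate: "integrable M (\<lambda>\<omega>. h (x m \<omega>) :: real)"
  using integrable_trajectory[of "\<lambda>u v c. h u" m m 0] .

lemma integrable_f [simp]: "integrable M (\<lambda>\<omega>. f (x m \<omega>))"
  by (rule integrable_iterate)

lemma integrable_gradient [simp]: "integrable M (\<lambda>\<omega>. (norm (g (x m \<omega>)))\<^sup>2)"
  by (rule integrable_iterate)

text \<open>Both iterates are fixed before \<open>i j\<close> is drawn, so averaging over the fresh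
  index turns a product of sampled components into the inner product divided by
  \<open>n\<close>.\<close>

lemma expectation_sample:
  assumes "m \<le> j" "m' \<le> j"
  shows "expectation (\<lambda>\<omega>. g (x m \<omega>) $ i j \<omega> * g (x m' \<omega>) $ i j \<omega>)
    = expectation (\<lambda>\<omega>. g (x m \<omega>) \<bullet> g (x m' \<omega>)) / real CARD('n)"
  using expectation_fresh_index[OF adapted_pair[OF assms], of "\<lambda>(u, v) c. g u $ c * g v $ c"]
  by (simp add: inner_vec_def)

section \<open>Growth and decay of the expected squared gradient norm\<close>

definition gradsq :: "nat \<Rightarrow> real" where
  "gradsq j = expectation (\<lambda>\<omega>. (norm (g (x j \<omega>)))\<^sup>2)"

lemma gradsq_nonneg: "0 \<le> gradsq j"
  by (simp add: gradsq_def)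

lemma expectation_sample_sq:
  assumes "m \<le> j"
  shows "expectation (\<lambda>\<omega>. (g (x m \<omega>) $ i j \<omega>)\<^sup>2) = gradsq m / real CARD('n)"
  using expectation_sample[OF assms assms]
  by (simp add: gradsq_def power2_norm_eq_inner) (simp add: power2_eq_square)

text \<open>A sampled component has expected square \<open>gradsq m' / n\<close>. Weighting the two
  squares by \<open>sqrt n\<close> balances it against the full norm, and this is the source of the
  \<open>sqrt n\<close> in \<open>q\<close>.\<close>

lemma expectation_norm_sample_le:
  assumes "m \<le> j" "m' \<le> j"
  shows "2 * expectation (\<lambda>\<omega>. norm (g (x m \<omega>)) * \<bar>g (x m' \<omega>) $ i j \<omega>\<bar>)
    \<le> (gradsq m + gradsq m') / sqrt (real CARD('n))"
proof -
  define r where "r = sqrt (real CARD('n))"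
  have r: "0 < r" "r * r = real CARD('n)" by (simp_all add: r_def)
  have "2 * expectation (\<lambda>\<omega>. norm (g (x m \<omega>)) * \<bar>g (x m' \<omega>) $ i j \<omega>\<bar>)
      = expectation (\<lambda>\<omega>. 2 * (norm (g (x m \<omega>)) * \<bar>g (x m' \<omega>) $ i j \<omega>\<bar>))"
    by simp
  also have "\<dots> \<le> expectation (\<lambda>\<omega>. (norm (g (x m \<omega>)))\<^sup>2 / r + r * (g (x m' \<omega>) $ i j \<omega>)\<^sup>2)"
    using integrable_trajectory[of "\<lambda>u v c. 2 * (norm (g u) * \<bar>g v $ c\<bar>)" m m' j]
      integrable_trajectory[of "\<lambda>u v c. (norm (g u))\<^sup>2 / r + r * (g v $ c)\<^sup>2" m m' j]
      mult_le_weighted_squares[OF r(1), of _ "\<bar>_\<bar>"]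
    by (intro integral_mono) simp_all
  also have "\<dots> = gradsq m / r + r * (gradsq m' / real CARD('n))"
    using integrable_trajectory[of "\<lambda>u v c. (g v $ c)\<^sup>2" m m' j] assms
    by (simp add: expectation_sample_sq gradsq_def)
  also have "\<dots> = (gradsq m + gradsq m') / r"
    using r(1) by (simp add: r(2)[symmetric] field_simps)
  finally show ?thesis by (simp add: r_def)
qed

lemma norm_gradient_step:
  assumes "\<omega> \<in> space M"
  shows "norm (g (x (Suc j) \<omega>) - g (x j \<omega>)) \<le> Lres * \<gamma> / Lmax * \<bar>g (x (k j) \<omega>) $ i j \<omega>\<bar>"
proof -
  have "norm (g (x j \<omega>) - g (x (Suc j) \<omega>)) \<le> Lres * \<bar>- (\<gamma> / Lmax * g (x (k j) \<omega>) $ i j \<omega>)\<bar>"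
    using lipschitz unfolding restricted_lipschitz_def x_Suc[OF assms] by blast
  then show ?thesis
    using Lmax_pos gamma_pos by (simp add: abs_mult norm_minus_commute)
qed

text \<open>The factor \<open>sqrt n\<close> exposed here cancels the one in
  \<open>expectation_norm_sample_le\<close>, leaving bounds in \<open>\<gamma> * q\<close>.\<close>

lemma coefficient_eq: "Lres * \<gamma> / Lmax = \<gamma> * q * sqrt (real CARD('n))"
  by (simp add: q_def)

lemma gradsq_decrease: "gradsq j - gradsq (Suc j) \<le> \<gamma> * q * (gradsq j + gradsq (k j))"
proof -
  define \<beta> where "\<beta> = Lres * \<gamma> / Lmax"
  have \<beta>: "0 \<le> \<beta>" using Lmax_pos Lres_nonneg gamma_pos by (simp add: \<beta>_def)
  have pt: "(norm (g (x j \<omega>)))\<^sup>2 - (norm (g (x (Suc j) \<omega>)))\<^sup>2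
      \<le> \<beta> * (2 * (norm (g (x j \<omega>)) * \<bar>g (x (k j) \<omega>) $ i j \<omega>\<bar>))" if "\<omega> \<in> space M" for \<omega>
  proof -
    define u v where "u = norm (g (x j \<omega>))" and "v = norm (g (x (Suc j) \<omega>))"
    have "u - v \<le> \<beta> * \<bar>g (x (k j) \<omega>) $ i j \<omega>\<bar>"
      using norm_gradient_step[OF that, of j] norm_triangle_ineq2[of "g (x j \<omega>)" "g (x (Suc j) \<omega>)"]
      by (simp add: u_def v_def \<beta>_def norm_minus_commute)
    then have "2 * u * (u - v) \<le> 2 * u * (\<beta> * \<bar>g (x (k j) \<omega>) $ i j \<omega>\<bar>)"
      by (intro mult_left_mono) (auto simp: u_def)
    \<comment> \<open>In this direction the second-order term has a favourable sign and is dropped;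
      in \<open>gradsq_increase\<close> it survives as the summand with
      \<open>(\<gamma> * q)\<^sup>2\<close>.\<close>
    moreover have "u\<^sup>2 - v\<^sup>2 = 2 * u * (u - v) - (u - v)\<^sup>2"
      by (simp add: power2_eq_square algebra_simps)
    ultimately show ?thesis
      unfolding u_def[symmetric] v_def[symmetric] using zero_le_power2[of "u - v"] by argo
  qed
  have "gradsq j - gradsq (Suc j)
      = expectation (\<lambda>\<omega>. (norm (g (x j \<omega>)))\<^sup>2 - (norm (g (x (Suc j) \<omega>)))\<^sup>2)"
    by (simp add: gradsq_def)
  also have "\<dots> \<le> expectation (\<lambda>\<omega>. \<beta> * (2 * (norm (g (x j \<omega>)) * \<bar>g (x (k j) \<omega>) $ i j \<omega>\<bar>)))"
    using pt integrable_trajectory[of "\<lambda>u v c. \<beta> * (2 * (norm (g u) * \<bar>g v $ c\<bar>))" j "k j" j]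
    by (intro integral_mono) simp_all
  also have "\<dots> = \<beta> * (2 * expectation (\<lambda>\<omega>. norm (g (x j \<omega>)) * \<bar>g (x (k j) \<omega>) $ i j \<omega>\<bar>))"
    by simp
  also have "\<dots> \<le> \<beta> * ((gradsq j + gradsq (k j)) / sqrt (real CARD('n)))"
    using \<beta> k_le by (intro mult_left_mono expectation_norm_sample_le) auto
  also have "\<dots> = \<gamma> * q * (gradsq j + gradsq (k j))"
    by (simp add: \<beta>_def coefficient_eq)
  finally show ?thesis .
qed

lemma gradsq_increase:
  "gradsq (Suc j) - gradsq j \<le> \<gamma> * q * (gradsq j + gradsq (k j)) + (\<gamma> * q)\<^sup>2 * gradsq (k j)"
proof -
  define \<beta> where "\<beta> = Lres * \<gamma> / Lmax"
  have \<beta>: "0 \<le> \<beta>" using Lmax_pos Lres_nonneg gamma_pos by (simp add: \<beta>_def)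
  let ?B = "\<lambda>u v c. \<beta> * (2 * (norm (g u) * \<bar>g v $ c\<bar>)) + \<beta>\<^sup>2 * (g v $ c)\<^sup>2"
  have pt: "(norm (g (x (Suc j) \<omega>)))\<^sup>2 - (norm (g (x j \<omega>)))\<^sup>2
      \<le> ?B (x j \<omega>) (x (k j) \<omega>) (i j \<omega>)" if "\<omega> \<in> space M" for \<omega>
  proof -
    have "norm (g (x (Suc j) \<omega>)) \<le> norm (g (x j \<omega>)) + \<beta> * \<bar>g (x (k j) \<omega>) $ i j \<omega>\<bar>"
      using norm_gradient_step[OF that, of j] norm_triangle_ineq2[of "g (x (Suc j) \<omega>)" "g (x j \<omega>)"]
      by (simp add: \<beta>_def)
    then have "(norm (g (x (Suc j) \<omega>)))\<^sup>2 \<le> (norm (g (x j \<omega>)) + \<beta> * \<bar>g (x (k j) \<omega>) $ i j \<omega>\<bar>)\<^sup>2"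
      by (rule power_mono) simp
    then show ?thesis by (simp add: power2_sum power_mult_distrib mult_ac)
  qed
  have "gradsq (Suc j) - gradsq j
      = expectation (\<lambda>\<omega>. (norm (g (x (Suc j) \<omega>)))\<^sup>2 - (norm (g (x j \<omega>)))\<^sup>2)"
    by (simp add: gradsq_def)
  also have "\<dots> \<le> expectation (\<lambda>\<omega>. ?B (x j \<omega>) (x (k j) \<omega>) (i j \<omega>))"
    using pt integrable_trajectory[of ?B j "k j" j] by (intro integral_mono) simp_all
  also have "\<dots> = \<beta> * (2 * expectation (\<lambda>\<omega>. norm (g (x j \<omega>)) * \<bar>g (x (k j) \<omega>) $ i j \<omega>\<bar>))
      + \<beta>\<^sup>2 * (gradsq (k j) / real CARD('n))"
    using integrable_trajectory[of "\<lambda>u v c. norm (g u) * \<bar>g v $ c\<bar>" j "k j" j]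
      integrable_trajectory[of "\<lambda>u v c. (g v $ c)\<^sup>2" j "k j" j] k_le[of j]
    by (simp add: expectation_sample_sq)
  also have "\<dots> \<le> \<beta> * ((gradsq j + gradsq (k j)) / sqrt (real CARD('n)))
      + \<beta>\<^sup>2 * (gradsq (k j) / real CARD('n))"
    using \<beta> k_le by (intro add_right_mono mult_left_mono expectation_norm_sample_le) auto
  also have "\<dots> = \<gamma> * q * (gradsq j + gradsq (k j)) + (\<gamma> * q)\<^sup>2 * gradsq (k j)"
    by (simp add: \<beta>_def coefficient_eq power_mult_distrib)
  finally show ?thesis .
qed

lemma rho_power_ge_1: "1 \<le> \<rho> ^ \<tau>"
  using rho_ge_1 by simp

text \<open>The induction hypothesis at the indices from \<open>k j\<close> to \<open>j - 1\<close>
  bounds \<open>gradsq (k j)\<close> by \<open>\<rho> ^ \<tau> * gradsq j\<close>, so one step loses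
  at most the fraction \<open>2 * \<gamma> * q * \<rho> ^ \<tau>\<close>. By
  \<open>gamma_le1\<close>, \<rho> times the remaining fraction is at least 1.\<close>

lemma gradsq_le_Suc: "gradsq j \<le> \<rho> * gradsq (Suc j)"
proof (induction j rule: less_induct)
  case (less j)
  have "gradsq (k j) \<le> \<rho> ^ \<tau> * gradsq j"
    using less.IH rho_ge_1 k_le le_k gradsq_nonneg by (intro geometric_ratio_le) auto
  moreover have "gradsq j \<le> \<rho> ^ \<tau> * gradsq j"
    using mult_right_mono[OF rho_power_ge_1 gradsq_nonneg] by simp
  ultimately have "\<gamma> * q * (gradsq j + gradsq (k j)) \<le> \<gamma> * q * (2 * (\<rho> ^ \<tau> * gradsq j))"
    using gamma_pos q_nonneg by (intro mult_left_mono) auto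
  then have "gradsq j * (1 - 2 * \<gamma> * q * \<rho> ^ \<tau>) \<le> gradsq (Suc j)"
    using gradsq_decrease[of j] by (simp add: algebra_simps)
  then have "\<rho> * (gradsq j * (1 - 2 * \<gamma> * q * \<rho> ^ \<tau>)) \<le> \<rho> * gradsq (Suc j)"
    using rho_ge_1 by (intro mult_left_mono) auto
  moreover have "gradsq j * 1 \<le> gradsq j * (\<rho> - 2 * \<gamma> * q * \<rho> ^ (\<tau> + 1))"
    using gamma_le1 gradsq_nonneg by (intro mult_left_mono) auto
  ultimately show ?case by (simp add: algebra_simps)
qed

lemma gradsq_Suc_le: "gradsq (Suc j) \<le> \<rho> * gradsq j"
proof -
  have k: "gradsq (k j) \<le> \<rho> ^ \<tau> * gradsq j"
    using rho_ge_1 k_le le_k gradsq_nonneg gradsq_le_Suc by (intro geometric_ratio_le) auto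
  have "gradsq j \<le> \<rho> ^ \<tau> * gradsq j"
    using mult_right_mono[OF rho_power_ge_1 gradsq_nonneg] by simp
  with k have "\<gamma> * q * (gradsq j + gradsq (k j)) \<le> \<gamma> * q * (2 * (\<rho> ^ \<tau> * gradsq j))"
    using gamma_pos q_nonneg by (intro mult_left_mono) auto
  moreover have "(\<gamma> * q)\<^sup>2 * gradsq (k j) \<le> (\<gamma> * q)\<^sup>2 * (\<rho> ^ \<tau> * gradsq j)"
    using k by (intro mult_left_mono) auto
  ultimately have "gradsq (Suc j) - gradsq j \<le> (\<gamma> * q * \<rho> ^ \<tau> * (2 + \<gamma> * q)) * gradsq j"
    using gradsq_increase[of j] by (simp add: algebra_simps power2_eq_square)
  also have "\<dots> \<le> (\<rho> - 1) * gradsq j"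
    by (intro mult_right_mono gamma_le2 gradsq_nonneg)
  finally show ?thesis by (simp add: algebra_simps)
qed

lemma gradsq_comparable:
  assumes "m \<le> b + \<tau>" "b \<le> m + \<tau>"
  shows "gradsq m \<le> \<rho> ^ \<tau> * gradsq b"
proof (cases "m \<le> b")
  case True
  with assms show ?thesis
    using gradsq_le_Suc rho_ge_1 gradsq_nonneg by (intro geometric_ratio_le) auto
next
  case False
  with assms show ?thesis
    using gradsq_Suc_le rho_ge_1 gradsq_nonneg by (intro geometric_ratio_ge) auto
qed

section \<open>Staleness error and expected descent\<close>

text \<open>The gradient difference telescopes over at most \<tau> updates \<open>d\<close>. As
  \<open>k j \<le> d\<close>, the iterate \<open>x (k j)\<close> precedes the draw of
  \<open>i d\<close>, so \<open>expectation_norm_sample_le\<close> bounds each term.\<close>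

lemma stale_gradient_error:
  "expectation (\<lambda>\<omega>. norm (g (x (k j) \<omega>)) * norm (g (x j \<omega>) - g (x (k j) \<omega>)))
    \<le> \<gamma> * (real \<tau> * \<rho> ^ \<tau> * q) * gradsq (k j)"
proof -
  define \<beta> where "\<beta> = Lres * \<gamma> / Lmax"
  have \<beta>: "0 \<le> \<beta>" using Lmax_pos Lres_nonneg gamma_pos by (simp add: \<beta>_def)
  define D where "D = {k j..<j}"
  have D: "real (card D) \<le> real \<tau>" using le_k[of j] by (simp add: D_def)
  let ?N = "\<lambda>d \<omega>. norm (g (x (k j) \<omega>)) * \<bar>g (x (k d) \<omega>) $ i d \<omega>\<bar>"
  have int: "integrable M (?N d)" for d
    using integrable_trajectory[of "\<lambda>u v c. norm (g u) * \<bar>g v $ c\<bar>" "k j" "k d" d] .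
  have pt: "norm (g (x (k j) \<omega>)) * norm (g (x j \<omega>) - g (x (k j) \<omega>)) \<le> (\<Sum>d\<in>D. \<beta> * ?N d \<omega>)"
    if "\<omega> \<in> space M" for \<omega>
  proof -
    have "g (x j \<omega>) - g (x (k j) \<omega>) = (\<Sum>d\<in>D. g (x (Suc d) \<omega>) - g (x d \<omega>))"
      unfolding D_def by (rule sum_Suc_diff'[symmetric]) (rule k_le)
    also have "norm \<dots> \<le> (\<Sum>d\<in>D. \<beta> * \<bar>g (x (k d) \<omega>) $ i d \<omega>\<bar>)"
      unfolding \<beta>_def by (intro sum_norm_le norm_gradient_step that)
    finally have "norm (g (x (k j) \<omega>)) * norm (g (x j \<omega>) - g (x (k j) \<omega>))
        \<le> norm (g (x (k j) \<omega>)) * (\<Sum>d\<in>D. \<beta> * \<bar>g (x (k d) \<omega>) $ i d \<omega>\<bar>)"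
      by (intro mult_left_mono) auto
    then show ?thesis by (simp add: sum_distrib_left mult_ac)
  qed
  have "expectation (\<lambda>\<omega>. norm (g (x (k j) \<omega>)) * norm (g (x j \<omega>) - g (x (k j) \<omega>)))
      \<le> expectation (\<lambda>\<omega>. \<Sum>d\<in>D. \<beta> * ?N d \<omega>)"
    using pt int integrable_trajectory[of "\<lambda>u v c. norm (g u) * norm (g v - g u)" "k j" j 0]
    by (intro integral_mono) simp_all
  also have "\<dots> = (\<Sum>d\<in>D. \<beta> / 2 * (2 * expectation (?N d)))"
    using int by simp
  also have "\<dots> \<le> (\<Sum>d\<in>D. \<gamma> * q * \<rho> ^ \<tau> * gradsq (k j))"
  proof (rule sum_mono)
    fix d
    assume d: "d \<in> D"
    have "2 * expectation (?N d) \<le> (gradsq (k j) + gradsq (k d)) / sqrt (real CARD('n))"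
      using d k_le[of d] by (intro expectation_norm_sample_le) (auto simp: D_def)
    \<comment> \<open>\<open>k d\<close> may lie on either side of \<open>k j\<close>, but within
      \<tau> of it: \<open>k d \<le> d < j \<le> k j + \<tau>\<close> and
      \<open>k j \<le> d \<le> k d + \<tau>\<close>.\<close>
    moreover have "gradsq (k d) \<le> \<rho> ^ \<tau> * gradsq (k j)"
      using d k_le[of d] le_k[of d] le_k[of j] by (intro gradsq_comparable) (auto simp: D_def)
    moreover have "gradsq (k j) \<le> \<rho> ^ \<tau> * gradsq (k j)"
      using mult_right_mono[OF rho_power_ge_1 gradsq_nonneg] by simp
    ultimately have "2 * expectation (?N d) \<le> (2 * (\<rho> ^ \<tau> * gradsq (k j))) / sqrt (real CARD('n))"
      by (smt (verit, ccfv_SIG) divide_right_mono real_sqrt_ge_zero of_nat_0_le_iff)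
    then have "\<beta> / 2 * (2 * expectation (?N d))
        \<le> \<beta> / 2 * ((2 * (\<rho> ^ \<tau> * gradsq (k j))) / sqrt (real CARD('n)))"
      using \<beta> by (intro mult_left_mono) auto
    then show "\<beta> / 2 * (2 * expectation (?N d)) \<le> \<gamma> * q * \<rho> ^ \<tau> * gradsq (k j)"
      by (simp add: \<beta>_def coefficient_eq)
  qed
  also have "\<dots> = real (card D) * (\<gamma> * q * \<rho> ^ \<tau> * gradsq (k j))" by simp
  also have "\<dots> \<le> real \<tau> * (\<gamma> * q * \<rho> ^ \<tau> * gradsq (k j))"
    using D gamma_pos q_nonneg rho_ge_1 gradsq_nonneg by (intro mult_right_mono) auto
  finally show ?thesis by (simp add: mult_ac)
qed

lemma expected_descent:
  defines "\<psi> \<equiv> 1 + 2 * real \<tau> * \<rho> ^ \<tau> * q"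
  shows "expectation (\<lambda>\<omega>. f (x (Suc j) \<omega>))
    \<le> expectation (\<lambda>\<omega>. f (x j \<omega>)) - \<gamma> * (1 - \<gamma> * \<psi> / 2) / (real CARD('n) * Lmax) * gradsq (k j)"
proof -
  define s where "s = \<gamma> / Lmax"
  have s: "0 < s" using gamma_pos Lmax_pos by (simp add: s_def)
  let ?B = "\<lambda>u v c. - s * (g u $ c * g v $ c) + Lmax / 2 * s\<^sup>2 * (g v $ c)\<^sup>2"
  have pt: "f (x (Suc j) \<omega>) - f (x j \<omega>) \<le> ?B (x j \<omega>) (x (k j) \<omega>) (i j \<omega>)" if "\<omega> \<in> space M" for \<omega>
  proof -
    let ?t = "- (\<gamma> / Lmax * g (x (k j) \<omega>) $ i j \<omega>)"
    have "f (x (Suc j) \<omega>) - f (x j \<omega>) \<le> g (x j \<omega>) $ i j \<omega> * ?t + Lmax / 2 * ?t\<^sup>2"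
      using coord unfolding coord_lipschitz_def x_Suc[OF that] by blast
    then show ?thesis unfolding s_def using Lmax_pos by (simp add: power2_eq_square mult_ac)
  qed
  have int: "integrable M (\<lambda>\<omega>. g (x j \<omega>) $ i j \<omega> * g (x (k j) \<omega>) $ i j \<omega>)"
    "integrable M (\<lambda>\<omega>. (g (x (k j) \<omega>) $ i j \<omega>)\<^sup>2)"
    "integrable M (\<lambda>\<omega>. g (x j \<omega>) \<bullet> g (x (k j) \<omega>))"
    "integrable M (\<lambda>\<omega>. norm (g (x (k j) \<omega>)) * norm (g (x j \<omega>) - g (x (k j) \<omega>)))"
    using integrable_trajectory[of "\<lambda>u v c. g u $ c * g v $ c" j "k j" j]
      integrable_trajectory[of "\<lambda>u v c. (g v $ c)\<^sup>2" j "k j" j]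
      integrable_trajectory[of "\<lambda>u v c. g u \<bullet> g v" j "k j" j]
      integrable_trajectory[of "\<lambda>u v c. norm (g v) * norm (g u - g v)" j "k j" j]
    by simp_all
  have "gradsq (k j) - expectation (\<lambda>\<omega>. g (x j \<omega>) \<bullet> g (x (k j) \<omega>))
      = expectation (\<lambda>\<omega>. (norm (g (x (k j) \<omega>)))\<^sup>2 - g (x j \<omega>) \<bullet> g (x (k j) \<omega>))"
    using int by (simp add: gradsq_def)
  also have "\<dots> \<le> expectation (\<lambda>\<omega>. norm (g (x (k j) \<omega>)) * norm (g (x j \<omega>) - g (x (k j) \<omega>)))"
  proof (rule integral_mono)
    fix \<omega>
    have "(norm (g (x (k j) \<omega>)))\<^sup>2 - g (x j \<omega>) \<bullet> g (x (k j) \<omega>)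
        = g (x (k j) \<omega>) \<bullet> (g (x (k j) \<omega>) - g (x j \<omega>))"
      unfolding power2_norm_eq_inner by (simp add: inner_diff_right inner_commute)
    also have "\<dots> \<le> norm (g (x (k j) \<omega>)) * norm (g (x (k j) \<omega>) - g (x j \<omega>))"
      by (rule norm_cauchy_schwarz)
    finally show "(norm (g (x (k j) \<omega>)))\<^sup>2 - g (x j \<omega>) \<bullet> g (x (k j) \<omega>)
        \<le> norm (g (x (k j) \<omega>)) * norm (g (x j \<omega>) - g (x (k j) \<omega>))"
      by (simp add: norm_minus_commute)
  qed (use int in simp_all)
  also note stale_gradient_error
  finally have inner: "(1 - \<gamma> * (real \<tau> * \<rho> ^ \<tau> * q)) * gradsq (k j)
      \<le> expectation (\<lambda>\<omega>. g (x j \<omega>) \<bullet> g (x (k j) \<omega>))" by (simp add: algebra_simps)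
  have "expectation (\<lambda>\<omega>. f (x (Suc j) \<omega>)) - expectation (\<lambda>\<omega>. f (x j \<omega>))
      = expectation (\<lambda>\<omega>. f (x (Suc j) \<omega>) - f (x j \<omega>))" by simp
  also have "\<dots> \<le> expectation (\<lambda>\<omega>. ?B (x j \<omega>) (x (k j) \<omega>) (i j \<omega>))"
    using pt integrable_trajectory[of ?B j "k j" j] by (intro integral_mono) simp_all
  also have "\<dots> = - s * (expectation (\<lambda>\<omega>. g (x j \<omega>) \<bullet> g (x (k j) \<omega>)) / real CARD('n))
      + Lmax / 2 * s\<^sup>2 * (gradsq (k j) / real CARD('n))"
    using int by (subst Bochner_Integration.integral_add)
      (simp_all add: expectation_sample expectation_sample_sq k_le)
  also have "\<dots> \<le> - s * ((1 - \<gamma> * (real \<tau> * \<rho> ^ \<tau> * q)) * gradsq (k j) / real CARD('n))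
      + Lmax / 2 * s\<^sup>2 * (gradsq (k j) / real CARD('n))"
    using inner s by (intro add_right_mono mult_left_mono_neg divide_right_mono) auto
  \<comment> \<open>The staleness loss \<open>\<gamma> * \<tau> * \<rho> ^ \<tau> * q\<close> and
    the loss \<open>\<gamma> / 2\<close> from the quadratic term add up to
    \<open>\<gamma> * \<psi> / 2\<close>, which explains the form of \<psi>.\<close>
  also have "\<dots> = - (\<gamma> * (1 - \<gamma> * \<psi> / 2) / (real CARD('n) * Lmax) * gradsq (k j))"
    using Lmax_pos by (simp add: s_def \<psi>_def power2_eq_square field_simps)
  finally show ?thesis by simp
qed

end

section \<open>Consequences of the delay bound for the constants\<close>

lemma steplength_constants:
  fixes r q \<rho> \<psi> \<gamma> :: real
  assumes r: "0 < r" "(real \<tau> + 1) * r \<le> 1" and q: "q = r / (2 * exp 1)"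
    and \<rho>: "\<rho> = 1 + r" and \<psi>: "\<psi> = 1 + 2 * real \<tau> * \<rho> ^ \<tau> * q" and \<gamma>: "\<gamma> = 1 / \<psi>"
  shows "1 \<le> \<psi>" "\<psi> \<le> 2" "2 * \<gamma> * q * \<rho> ^ (\<tau> + 1) \<le> \<rho> - 1"
    "\<gamma> * q * \<rho> ^ \<tau> * (2 + \<gamma> * q) \<le> \<rho> - 1"
proof -
  have e: "1 \<le> 2 * exp (1 :: real)" using one_le_exp_iff[of "1 :: real"] by linarith
  have "\<rho> ^ (\<tau> + 1) \<le> exp r ^ (\<tau> + 1)"
    unfolding \<rho> using r(1) exp_ge_add_one_self by (intro power_mono) auto
  also have "\<dots> = exp ((real \<tau> + 1) * r)"
    by (simp add: exp_of_nat_mult[symmetric] exp_add[symmetric] algebra_simps)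
  also have "\<dots> \<le> exp 1" using r(2) by simp
  finally have \<rho>e: "\<rho> ^ (\<tau> + 1) \<le> exp 1" .
  have \<rho>1: "1 \<le> \<rho>" using r \<rho> by simp
  have \<rho>\<tau>: "1 \<le> \<rho> ^ \<tau>" "\<rho> ^ \<tau> \<le> \<rho> ^ (\<tau> + 1)"
    using \<rho>1 by (auto intro: power_increasing)
  have \<rho>\<tau>_exp: "\<rho> ^ \<tau> \<le> exp 1" using \<rho>\<tau>(2) \<rho>e by linarith
  have q0: "0 \<le> q" using r q by simp
  show \<psi>1: "1 \<le> \<psi>" using q0 \<rho>1 \<psi> by simp
  \<comment> \<open>The factor \<open>2 * exp 1\<close> between \<open>r\<close> and
    \<open>q\<close> is chosen so that \<open>\<rho> ^ \<tau> / exp 1\<close> is at most 1.\<close>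
  have "\<psi> = 1 + real \<tau> * r * (\<rho> ^ \<tau> / exp 1)" by (simp add: \<psi> q)
  also have "\<dots> \<le> 1 + real \<tau> * r * 1"
    using r \<rho>\<tau>_exp by (intro add_left_mono mult_left_mono) auto
  also have "\<dots> \<le> 2" using r by (simp add: algebra_simps)
  finally show "\<psi> \<le> 2" .
  have \<gamma>1: "0 \<le> \<gamma>" "\<gamma> \<le> 1" using \<psi>1 \<gamma> by auto
  have "2 * \<gamma> * q * \<rho> ^ (\<tau> + 1) \<le> 2 * 1 * q * exp 1"
    using \<gamma>1 q0 \<rho>e \<rho>1 by (intro mult_mono) auto
  also have "\<dots> = \<rho> - 1" by (simp add: q \<rho>)
  finally show "2 * \<gamma> * q * \<rho> ^ (\<tau> + 1) \<le> \<rho> - 1" .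
  have "q \<le> r / 1" unfolding q using r e by (intro divide_left_mono) auto
  then have \<gamma>q: "\<gamma> * q \<le> r" "\<gamma> * q \<le> q" "0 \<le> \<gamma> * q"
    using \<gamma>1 q0 mult_right_mono[OF \<gamma>1(2) q0] by auto
  \<comment> \<open>Since \<open>\<gamma> * q \<le> r\<close>, the last factor is at most
    \<open>2 + 2 * r = 2 * \<rho>\<close>, which supplies the missing power of \<rho>.\<close>
  have "\<gamma> * q * (\<rho> ^ \<tau> * (2 + \<gamma> * q)) \<le> q * (\<rho> ^ \<tau> * (2 * \<rho>))"
    using \<gamma>q q0 \<rho>1 \<rho> r by (intro mult_mono mult_left_mono) auto
  also have "\<dots> \<le> q * (2 * exp 1)"
    using \<rho>e q0 by (intro mult_left_mono) (simp_all add: mult_ac)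
  also have "\<dots> = \<rho> - 1" by (simp add: q \<rho>)
  finally show "\<gamma> * q * \<rho> ^ \<tau> * (2 + \<gamma> * q) \<le> \<rho> - 1" by (simp add: mult_ac)
qed

section \<open>Linear and sublinear convergence rates\<close>

theorem corollary2:
  fixes f :: "real ^ 'n \<Rightarrow> real" and g :: "real ^ 'n \<Rightarrow> real ^ 'n"
    and L :: "'n \<Rightarrow> real" and Lmax Lres \<rho> \<psi> \<gamma> :: real and \<tau> :: nat
    and M :: "'w measure" and i :: "nat \<Rightarrow> 'w \<Rightarrow> 'n" and k :: "nat \<Rightarrow> nat"
    and x0 :: "real ^ 'n" and x :: "nat \<Rightarrow> 'w \<Rightarrow> real ^ 'n"
  assumes convex: "convex_on UNIV f"
    and gradient: "\<And>y. GDERIV f y :> g y"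
    and minimizer: "minimizers f \<noteq> {}"
    and Lres: "restricted_lipschitz g Lres"
    and L: "coord_lipschitz f g L"
    and Lmax: "Lmax = Max (range L)"
    and tau_pos: "0 < \<tau>"
    and tau: "real \<tau> + 1 \<le> sqrt (real CARD('n)) * Lmax / (2 * exp 1 * Lres)"
    and rho: "\<rho> = 1 + 2 * exp 1 * Lres / (sqrt (real CARD('n)) * Lmax)"
    and psi: "\<psi> = 1 + 2 * real \<tau> * \<rho> ^ \<tau> * Lres / (sqrt (real CARD('n)) * Lmax)"
    and gamma: "\<gamma> = 1 / \<psi>"
    and prob: "prob_space M"
    and indices: "iid_uniform_indices M i"
    and delay: "bounded_delay \<tau> k"
    and iteration: "async_scd M i k g (\<gamma> / Lmax) x0 x"
  shows "(\<forall>l>0. essentially_strongly_convex f g l \<longrightarrow>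
            (\<forall>j. prob_space.expectation M (\<lambda>\<omega>. f (x j \<omega>) - opt_value f)
                 \<le> (1 - l / (2 * real CARD('n) * Lmax)) ^ j * (f x0 - opt_value f)))
       \<and> (\<forall>R. (AE \<omega> in M. \<forall>j. norm (x j \<omega> - closest_point (minimizers f) (x j \<omega>)) \<le> R) \<longrightarrow>
            (\<forall>j. prob_space.expectation M (\<lambda>\<omega>. f (x j \<omega>) - opt_value f)
                 \<le> 1 / (inverse (f x0 - opt_value f)
                          + real j / (4 * real CARD('n) * Lmax * R\<^sup>2))))"
proof -
  define n where "n = real CARD('n)"
  have n: "0 < n" by (simp add: n_def)
  have Lres0: "0 \<le> Lres"
  proof -
    have "0 \<le> norm (g 0 - g (0 + 1 *\<^sub>R axis undefined 1))" by simp
    also have "\<dots> \<le> Lres * \<bar>1\<bar>"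
      using Lres unfolding restricted_lipschitz_def by blast
    finally show ?thesis by simp
  qed
  have ratio: "0 < sqrt n * Lmax / (2 * exp 1 * Lres)"
    using tau unfolding n_def by (rule less_le_trans[rotated]) simp
  \<comment> \<open>For \<open>Lres = 0\<close> the quotient in \<open>ratio\<close> would be 0, by
    \<open>y / 0 = 0\<close>.\<close>
  then have Lres_pos: "0 < Lres" using Lres0 by (cases "Lres = 0") auto
  have Lmax_pos: "0 < Lmax"
    using ratio n Lres_pos by (simp add: zero_less_divide_iff zero_less_mult_iff mult_less_0_iff)
  define r where "r = 2 * exp 1 * Lres / (sqrt n * Lmax)"
  define q where q_eq: "q = Lres / (sqrt n * Lmax)"
  have r: "0 < r" "(real \<tau> + 1) * r \<le> 1"
    using tau n Lres_pos Lmax_pos unfolding r_def n_def[symmetric] by (simp_all add: field_simps)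
  have qr: "q = r / (2 * exp 1)" by (simp add: q_eq r_def)
  have \<rho>: "\<rho> = 1 + r" by (simp add: rho r_def n_def)
  have \<psi>: "\<psi> = 1 + 2 * real \<tau> * \<rho> ^ \<tau> * q" by (simp add: psi q_eq n_def)
  note const = steplength_constants[OF r qr \<rho> \<psi> gamma]
  have gamma_pos: "0 < \<gamma>" using const(1) gamma by simp
  have coord: "coord_lipschitz f g (\<lambda>_. Lmax)"
    unfolding coord_lipschitz_def
  proof (intro allI)
    fix c y t
    have "f (y + t *\<^sub>R axis c 1) - f y \<le> g y $ c * t + L c / 2 * t\<^sup>2"
      using L unfolding coord_lipschitz_def by blast
    also have "\<dots> \<le> g y $ c * t + Lmax / 2 * t\<^sup>2"
      unfolding Lmax by (intro add_left_mono mult_right_mono divide_right_mono) auto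
    finally show "f (y + t *\<^sub>R axis c 1) - f y \<le> g y $ c * t + Lmax / 2 * t\<^sup>2" .
  qed
  interpret prob_space M by (rule prob)
  interpret async_descent M i f g Lmax Lres \<gamma> \<rho> "Lres / (sqrt (real CARD('n)) * Lmax)" \<tau> k x0 x
    using indices Lres coord Lmax_pos Lres0 gamma_pos r(1) \<rho> const(3,4) delay iteration
    by unfold_locales (simp_all add: q_eq n_def)

  obtain z where z: "z \<in> minimizers f" using minimizer by blast
  define F where "F = f z"
  have F_le: "F \<le> f y" for y using z by (simp add: F_def minimizers_def)
  have opt: "opt_value f = F" using opt_value_eq[OF z] by (simp add: F_def)
  have "continuous_on UNIV f"
    using gradient by (intro continuous_at_imp_continuous_on)
      (auto simp: gderiv_def intro: has_derivative_continuous)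
  then have closed: "closed (minimizers f)" by (rule closed_minimizers)

  define \<phi> where "\<phi> j = expectation (\<lambda>\<omega>. f (x j \<omega>) - F)" for j
  \<comment> \<open>The 4 comes from \<open>\<gamma> * \<psi> = 1\<close>, which makes
    \<open>1 - \<gamma> * \<psi> / 2\<close> equal to 1/2, and from \<open>\<psi> \<le> 2\<close>,
    which gives \<open>\<gamma> \<ge> 1 / 2\<close>.\<close>
  define \<kappa> where "\<kappa> = 1 / (4 * n * Lmax)"
  have \<kappa>: "0 < \<kappa>" using n Lmax_pos by (simp add: \<kappa>_def)
  have \<phi>_nonneg: "0 \<le> \<phi> j" for j
    unfolding \<phi>_def using F_le by (intro Bochner_Integration.integral_nonneg) simp
  have \<phi>_0: "\<phi> 0 = f x0 - F"
  proof -
    have "\<phi> 0 = expectation (\<lambda>_. f x0 - F)"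
      unfolding \<phi>_def by (intro Bochner_Integration.integral_cong) (simp_all add: x_0)
    then show ?thesis by (simp add: prob_space)
  qed
  have \<phi>_Suc: "\<phi> (Suc j) \<le> \<phi> j - \<kappa> * gradsq (k j)" for j
  proof -
    have "\<gamma> * \<psi> = 1" using const(1) gamma by simp
    moreover have "1 / 2 \<le> \<gamma>"
      unfolding gamma using const(1,2) by (intro divide_left_mono) auto
    ultimately have "1 / 4 / (n * Lmax) \<le> \<gamma> * (1 - \<gamma> * \<psi> / 2) / (n * Lmax)"
      using n Lmax_pos by (intro divide_right_mono) simp_all
    then have "\<kappa> \<le> \<gamma> * (1 - \<gamma> * \<psi> / 2) / (n * Lmax)" by (simp add: \<kappa>_def mult.assoc)
    then have descent: "\<kappa> * gradsq (k j) \<le> \<gamma> * (1 - \<gamma> * \<psi> / 2) / (n * Lmax) * gradsq (k j)"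
      by (intro mult_right_mono gradsq_nonneg)
    have \<phi>_eq: "\<phi> m = expectation (\<lambda>\<omega>. f (x m \<omega>)) - F" for m
      by (simp add: \<phi>_def prob_space)
    show ?thesis
      using descent expected_descent[of j, folded n_def, folded q_eq, folded \<psi>]
      unfolding \<phi>_eq by linarith
  qed
  have \<phi>_antimono: "\<phi> b \<le> \<phi> a" if "a \<le> b" for a b
  proof (rule lift_Suc_antimono_le[OF _ that])
    show "\<phi> (Suc j) \<le> \<phi> j" for j
      using \<phi>_Suc[of j] mult_nonneg_nonneg[OF less_imp_le[OF \<kappa>] gradsq_nonneg[of "k j"]] by linarith
  qed

  have linear: "\<phi> j \<le> (1 - l / (2 * n * Lmax)) ^ j * \<phi> 0"
    if l: "0 < l" "essentially_strongly_convex f g l" for l j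
  \<comment> \<open>Bounding \<open>l\<close> means cancelling \<open>f x0 - F\<close>. If that gap
    is 0, monotonicity makes every later expected gap 0, whatever the sign of the rate.\<close>
  proof (cases "f x0 = F")
    case True
    then show ?thesis using \<phi>_antimono[of 0 j] \<phi>_0 by simp
  next
    case False
    note gap = essentially_strongly_convex_gap_le[OF l(2,1) closed z, folded F_def]
    have "2 * l * (f x0 - F) \<le> 2 * n * Lmax * (f x0 - F)"
      using gap[of x0] coord_lipschitz_norm_sq_le[OF coord Lmax_pos z, of x0]
      by (simp add: F_def n_def)
    then have "l \<le> n * Lmax" using False F_le[of x0] by simp
    then have "l \<le> 2 * n * Lmax" using mult_pos_pos[OF n Lmax_pos] by linarith
    then have rate: "0 \<le> 1 - l / (2 * n * Lmax)" using n Lmax_pos by (simp add: field_simps)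
    have gradsq: "2 * l * \<phi> m \<le> gradsq m" for m
    proof -
      have "expectation (\<lambda>\<omega>. 2 * l * (f (x m \<omega>) - F)) \<le> gradsq m"
        unfolding gradsq_def using gap by (intro integral_mono) simp_all
      then show ?thesis by (simp add: \<phi>_def)
    qed
    show ?thesis
    proof (induction j)
      case (Suc j)
      have "2 * l * \<phi> j \<le> 2 * l * \<phi> (k j)"
        using l \<phi>_antimono[OF k_le] by simp
      also have "\<dots> \<le> gradsq (k j)" by (rule gradsq)
      finally have "\<kappa> * (2 * l * \<phi> j) \<le> \<kappa> * gradsq (k j)" using \<kappa> by simp
      then have "\<phi> (Suc j) \<le> \<phi> j - \<kappa> * (2 * l * \<phi> j)" using \<phi>_Suc[of j] by linarith
      also have "\<dots> = (1 - l / (2 * n * Lmax)) * \<phi> j" by (simp add: \<kappa>_def algebra_simps)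
      also have "\<dots> \<le> (1 - l / (2 * n * Lmax)) * ((1 - l / (2 * n * Lmax)) ^ j * \<phi> 0)"
        by (intro mult_left_mono Suc.IH rate)
      finally show ?case by (simp add: mult_ac)
    qed simp
  qed

  have sublinear: "\<phi> j \<le> 1 / (inverse (\<phi> 0) + real j * (\<kappa> / R\<^sup>2))"
    if R: "AE \<omega> in M. \<forall>j. norm (x j \<omega> - closest_point (minimizers f) (x j \<omega>)) \<le> R" for R j
  proof (rule quadratic_decrease_bound[OF \<phi>_nonneg])
    have gradsq: "(\<phi> m)\<^sup>2 / R\<^sup>2 \<le> gradsq m" for m
    proof -
      let ?N = "\<lambda>\<omega>. norm (g (x m \<omega>))"
      have int: "integrable M ?N" by (rule integrable_iterate)
      have gap: "f y - F \<le> R * norm (g y)"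
        if "norm (y - closest_point (minimizers f) y) \<le> R" for y
      proof -
        define p where "p = closest_point (minimizers f) y"
        have "p \<in> minimizers f" unfolding p_def using closed z by (auto intro: closest_point_in_set)
        then have "f p = F" using opt opt_value_eq by metis
        then have "f y - F \<le> - (g y \<bullet> (p - y))"
          using gderiv_convex_above_tangent[OF convex gradient, of y p] by simp
        also have "\<dots> \<le> norm (g y) * norm (y - p)"
          using Cauchy_Schwarz_ineq2[of "g y" "p - y"] by (simp add: norm_minus_commute)
        also have "\<dots> \<le> norm (g y) * R" using that by (intro mult_left_mono) (auto simp: p_def)
        finally show ?thesis by (simp add: mult.commute)
      qed
      have "\<phi> m \<le> expectation (\<lambda>\<omega>. R * ?N \<omega>)"
        unfolding \<phi>_def using R int by (intro integral_mono_AE) (auto elim!: eventually_mono intro: gap)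
      then have "(\<phi> m)\<^sup>2 \<le> (R * expectation ?N)\<^sup>2"
        using \<phi>_nonneg by (intro power_mono) simp_all
      also have "\<dots> \<le> R\<^sup>2 * gradsq m"
      proof -
        \<comment> \<open>Nonnegative variance gives the case of Jensen's inequality needed here:
          the squared mean of the gradient norm is at most \<open>gradsq m\<close>.\<close>
        have "0 \<le> variance ?N" by (rule variance_positive)
        then have "(expectation ?N)\<^sup>2 \<le> gradsq m"
          using int by (simp add: variance_eq gradsq_def)
        then show ?thesis by (simp add: power_mult_distrib mult_left_mono)
      qed
      finally show ?thesis
        \<comment> \<open>for \<open>R = 0\<close> the left-hand side is \<open>0\<close>, by \<open>y / 0 = 0\<close>\<close>
        by (cases "R = 0") (simp_all add: gradsq_nonneg divide_le_eq mult.commute)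
    qed
    show "\<phi> (Suc j) \<le> \<phi> j - \<kappa> / R\<^sup>2 * (\<phi> j)\<^sup>2" for j
    proof -
      have "(\<phi> j)\<^sup>2 / R\<^sup>2 \<le> (\<phi> (k j))\<^sup>2 / R\<^sup>2"
        using \<phi>_antimono[OF k_le] \<phi>_nonneg by (intro divide_right_mono power_mono) auto
      also have "\<dots> \<le> gradsq (k j)" by (rule gradsq)
      finally have "\<kappa> * ((\<phi> j)\<^sup>2 / R\<^sup>2) \<le> \<kappa> * gradsq (k j)"
        by (rule mult_left_mono) (use \<kappa> in simp)
      then show ?thesis using \<phi>_Suc[of j] by simp
    qed
  qed (use \<kappa> in simp)

  show ?thesis
    using linear sublinear unfolding opt \<phi>_0 by (simp add: \<phi>_def \<kappa>_def n_def)
qed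

end
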